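(* Let $h>0$, let $(\varepsilon_i)_{i\in\mathbb{Z}}$ be a real sequence with $0<\varepsilon_{\min}\le\varepsilon_i\le\varepsilon_{\max}$ for all $i\in\mathbb{Z}$ and some constants $\varepsilon_{\min},\varepsilon_{\max}$, and let $\boldsymbol{u}=(u_i)_{i\in\mathbb{Z}}$ be a real sequence such that $$\boldsymbol{u}^{\mathsf T}\mathcal{B}\boldsymbol{u}=\sum_{i\in\mathbb{Z}}\varepsilon_i u_i^2<\infty$$ and $\varepsilon_i u_i\neq 0$ for every $i\in\mathbb{Z}$. Then the Rayleigh quotient $$\rho(\boldsymbol{u})=\frac{\boldsymbol{u}^{\mathsf T}\mathcal{A}\boldsymbol{u}}{\boldsymbol{u}^{\mathsf T}\mathcal{B}\boldsymbol{u}}$$ is the weighted average of the pointwise Rayleigh quotients $r_i=(\mathcal{A}\boldsymbol{u})_i/(\mathcal{B}\boldsymbol{u})_i$ with probability weights $p_i=\varepsilon_i u_i^2/(\boldsymbol{u}^{\mathsf T}\mathcal{B}\boldsymbol{u})$, that is, $$\rho(\boldsymbol{u})=\sum_{i\in\mathbb{Z}}p_i r_i=\mathbb{E}_{\mathrm p}\big[\{r_i\}_{i\in\mathbb{Z}}\big].$$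
   Context: For $h>0$, $\mathcal{A}$ and $\mathcal{B}$ act on real sequences indexed by $\mathbb{Z}$ by $$(\mathcal{A}\boldsymbol{u})_i=\frac{1}{h^2}\,(-u_{i-1}+2u_i-u_{i+1}),\qquad (\mathcal{B}\boldsymbol{u})_i=\varepsilon_i u_i,\qquad i\in\mathbb{Z}.$$ For real sequences, $\boldsymbol{u}^{\mathsf T}\boldsymbol{v}=\sum_{i\in\mathbb{Z}}u_i v_i$. For probability weights $\mathrm p=(p_i)_{i\in\mathbb{Z}}$ and a real sequence $(x_i)$, $\mathbb{E}_{\mathrm p}[\{x_i\}]=\sum_{i\in\mathbb{Z}}p_i x_i$. *)

theory Defs
  imports "HOL-Analysis.Infinite_Sum"
begin

definition opA :: "real \<Rightarrow> (int \<Rightarrow> real) \<Rightarrow> int \<Rightarrow> real" where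
  "opA h u i = (1 / h\<^sup>2) * (- u (i - 1) + 2 * u i - u (i + 1))"

definition opB :: "(int \<Rightarrow> real) \<Rightarrow> (int \<Rightarrow> real) \<Rightarrow> int \<Rightarrow> real" where
  "opB \<epsilon> u i = \<epsilon> i * u i"

text \<open>Bilateral series are unconditional sums over the integers. The value of
  an infinite sum that does not converge is \<open>0\<close>, so convergence
  is always asserted separately from the value.\<close>

definition pairing :: "(int \<Rightarrow> real) \<Rightarrow> (int \<Rightarrow> real) \<Rightarrow> real" where
  "pairing u v = (\<Sum>\<^sub>\<infinity>i. u i * v i)"

definition rayleigh :: "real \<Rightarrow> (int \<Rightarrow> real) \<Rightarrow> (int \<Rightarrow> real) \<Rightarrow> real" where
  "rayleigh h \<epsilon> u = pairing u (opA h u) / pairing u (opB \<epsilon> u)"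

definition local_rayleigh :: "real \<Rightarrow> (int \<Rightarrow> real) \<Rightarrow> (int \<Rightarrow> real) \<Rightarrow> int \<Rightarrow> real" where
  "local_rayleigh h \<epsilon> u i = opA h u i / opB \<epsilon> u i"

definition weight :: "(int \<Rightarrow> real) \<Rightarrow> (int \<Rightarrow> real) \<Rightarrow> int \<Rightarrow> real" where
  "weight \<epsilon> u i = \<epsilon> i * (u i)\<^sup>2 / pairing u (opB \<epsilon> u)"

definition probability_weights :: "(int \<Rightarrow> real) \<Rightarrow> bool" where
  "probability_weights p \<longleftrightarrow> (\<forall>i. 0 \<le> p i) \<and> (p has_sum 1) UNIV"

definition weighted_mean :: "(int \<Rightarrow> real) \<Rightarrow> (int \<Rightarrow> real) \<Rightarrow> real" where
  "weighted_mean p x = (\<Sum>\<^sub>\<infinity>i. p i * x i)"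

end

theory Submission
  imports Defs
begin

text \<open>The lower bound on \<open>\<epsilon>\<close> makes \<open>u\<close> square summable, so the products of \<open>u\<close> with its
  shifts are summable and the numerator of the Rayleigh quotient converges. Since
  no \<open>u i\<close> vanishes, the weighted local quotient at \<open>i\<close> is \<open>u i * opA h u i\<close> divided by
  \<open>pairing u (opB \<epsilon> u)\<close>, and summing these identities gives the claim.\<close>

lemma square_summable_shift:
  fixes u :: "int \<Rightarrow> real"
  assumes "(\<lambda>i. (u i)\<^sup>2) summable_on UNIV"
  shows "(\<lambda>i. (u (i + k))\<^sup>2) summable_on UNIV"
proof -
  have "bij_betw (\<lambda>i::int. i + k) UNIV UNIV"
    by (rule bij_betwI[where g = "\<lambda>i. i - k"]) auto
  from summable_on_reindex_bij_betw[OF this, of "\<lambda>i. (u i)\<^sup>2"] assms show ?thesis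
    by simp
qed

text \<open>Comparison with the sum of the two squares, which by AM-GM dominates even twice the
  absolute value of the product.\<close>

lemma square_summable_mult:
  fixes u v :: "'a \<Rightarrow> real"
  assumes "(\<lambda>i. (u i)\<^sup>2) summable_on A" and "(\<lambda>i. (v i)\<^sup>2) summable_on A"
  shows "(\<lambda>i. u i * v i) summable_on A"
proof (rule abs_summable_summable, rule abs_summable_on_comparison_test')
  show "(\<lambda>i. (u i)\<^sup>2 + (v i)\<^sup>2) summable_on A"
    using assms by (rule summable_on_add)
  fix i
  have "2 * (\<bar>u i\<bar> * \<bar>v i\<bar>) \<le> (u i)\<^sup>2 + (v i)\<^sup>2"
    using sum_squares_bound[of "\<bar>u i\<bar>" "\<bar>v i\<bar>"] by simp
  moreover have "0 \<le> \<bar>u i\<bar> * \<bar>v i\<bar>"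
    by simp
  ultimately show "norm (u i * v i) \<le> (u i)\<^sup>2 + (v i)\<^sup>2"
    unfolding real_norm_def abs_mult by linarith
qed

lemma summable_mult_opA:
  assumes "(\<lambda>i. (u i)\<^sup>2) summable_on UNIV"
  shows "(\<lambda>i. u i * opA h u i) summable_on UNIV"
proof -
  have shift: "(\<lambda>i. u i * u (i + k)) summable_on UNIV" for k
    using square_summable_mult[OF assms square_summable_shift[OF assms]] .
  \<comment> \<open>This is \<open>u i * opA h u i\<close> expanded, up to the factor
    \<open>1 / h\<^sup>2\<close>; writing differences with coefficient -1 leaves only sums and
    scalar multiples.\<close>
  have "(\<lambda>i. 2 * (u i)\<^sup>2 + (- 1) * (u i * u (i - 1)) + (- 1) * (u i * u (i + 1))) summable_on UNIV"
    using shift[of "-1"] shift[of 1] assms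
    by (intro summable_on_add summable_on_cmult_right) simp_all
  from summable_on_cmult_right[OF this, of "1 / h\<^sup>2"]
  show ?thesis
    by (rule back_subst[of "\<lambda>f. f summable_on UNIV"])
      (simp add: opA_def fun_eq_iff field_simps power2_eq_square)
qed

theorem theorem4p1:
  fixes h \<epsilon>min \<epsilon>max :: real and \<epsilon> u :: "int \<Rightarrow> real"
  assumes "h > 0"
    and "0 < \<epsilon>min"
    and "\<And>i. \<epsilon>min \<le> \<epsilon> i" and "\<And>i. \<epsilon> i \<le> \<epsilon>max"
    and "(\<lambda>i. \<epsilon> i * (u i)\<^sup>2) summable_on UNIV"
    and "\<And>i. \<epsilon> i * u i \<noteq> 0"
  shows "pairing u (opB \<epsilon> u) = (\<Sum>\<^sub>\<infinity>i. \<epsilon> i * (u i)\<^sup>2)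
    \<and> (\<lambda>i. u i * opA h u i) summable_on UNIV
    \<and> probability_weights (weight \<epsilon> u)
    \<and> ((\<lambda>i. weight \<epsilon> u i * local_rayleigh h \<epsilon> u i) has_sum rayleigh h \<epsilon> u) UNIV
    \<and> rayleigh h \<epsilon> u = weighted_mean (weight \<epsilon> u) (local_rayleigh h \<epsilon> u)"
proof -
  let ?S = "pairing u (opB \<epsilon> u)"
  have \<epsilon>_pos: "0 < \<epsilon> i" for i
    using assms(2,3) by (rule less_le_trans)
  have nonneg: "0 \<le> \<epsilon> i * (u i)\<^sup>2" for i
    using \<epsilon>_pos[of i] by simp
  have S: "?S = (\<Sum>\<^sub>\<infinity>i. \<epsilon> i * (u i)\<^sup>2)"
    by (simp add: pairing_def opB_def power2_eq_square mult_ac)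
  then have S_sum: "((\<lambda>i. \<epsilon> i * (u i)\<^sup>2) has_sum ?S) UNIV"
    using has_sum_infsum[OF assms(5)] by simp
  \<comment> \<open>A vanishing sum of nonnegative terms forces every term to vanish; the index 0 is
    an arbitrary choice, since no term is zero.\<close>
  have "?S \<noteq> 0"
  proof
    assume "?S = 0"
    then have "\<epsilon> 0 * (u 0)\<^sup>2 = 0"
      using nonneg_infsum_le_0D[OF _ assms(5), of 0] nonneg S by simp
    then show False
      using assms(6)[of 0] by simp
  qed
  moreover have "0 \<le> ?S"
    unfolding S using nonneg by (rule infsum_nonneg)
  ultimately have S_pos: "0 < ?S"
    by simp
  have "(\<lambda>i. (u i)\<^sup>2) summable_on UNIV"
  proof (rule summable_on_comparison_test)
    show "(\<lambda>i. (1 / \<epsilon>min) * (\<epsilon> i * (u i)\<^sup>2)) summable_on UNIV"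
      by (rule summable_on_cmult_right) fact
    \<comment> \<open>Multiply \<open>\<epsilon>min \<le> \<epsilon> i\<close> by the square of
      \<open>u i\<close> and divide by \<open>\<epsilon>min\<close>.\<close>
    show "(u i)\<^sup>2 \<le> (1 / \<epsilon>min) * (\<epsilon> i * (u i)\<^sup>2)" for i
      using mult_right_mono[OF assms(3)[of i], of "(u i)\<^sup>2"] assms(2)
      by (simp add: field_simps)
  qed simp
  then have A_summable: "(\<lambda>i. u i * opA h u i) summable_on UNIV"
    by (rule summable_mult_opA)
  have weights: "probability_weights (weight \<epsilon> u)"
    unfolding probability_weights_def weight_def
    using nonneg S_pos has_sum_cmult_right[OF S_sum, of "1 / ?S"] by simp
  have "weight \<epsilon> u i * local_rayleigh h \<epsilon> u i = 1 / ?S * (u i * opA h u i)" for i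
  proof -
    have "u i \<noteq> 0" "\<epsilon> i \<noteq> 0"
      using assms(6)[of i] by auto
    then show ?thesis
      by (simp add: weight_def local_rayleigh_def opB_def[of \<epsilon> u i] power2_eq_square)
  qed
  \<comment> \<open>Scaling the convergent numerator by \<open>1 / ?S\<close> gives the quotient.
    Only the numerator's \<open>pairing\<close> is unfolded, so the denominator remains
    \<open>?S\<close>.\<close>
  then have mean: "((\<lambda>i. weight \<epsilon> u i * local_rayleigh h \<epsilon> u i) has_sum rayleigh h \<epsilon> u) UNIV"
    using has_sum_cmult_right[OF has_sum_infsum[OF A_summable], of "1 / ?S"]
    by (simp add: rayleigh_def pairing_def[of u "opA h u"])
  \<comment> \<open>Convergence is already contained in \<open>mean\<close>, so the infinite sum
    here is a genuine limit and not the default value 0.\<close>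
  then have "rayleigh h \<epsilon> u = weighted_mean (weight \<epsilon> u) (local_rayleigh h \<epsilon> u)"
    unfolding weighted_mean_def by (simp add: infsumI)
  with S A_summable weights mean show ?thesis
    by blast
qed

end
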